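(* Consider one space dimension, constant matrices $\overline A,\overline B,\overline C,\overline D$ of sizes $N\times N$, $N\times P$, $P\times N$, $P\times P$, and the operators $A=\overline A\,\partial_x$, $B=\overline B\,\partial_x$, $C=\overline C\,\partial_x$, $D=\overline D\,\partial_x$. Let $\Phi(W)=E(x)\,W$ be a linear inhomogeneous equilibrium, with $E(x)$ a smooth $P\times N$ matrix-valued function of $x$, and let $\delta W=\partial_x\big(E(x)\,W\big)$. Let $\Sigma$ be a constant $P\times P$ matrix ($\Sigma=S^{-1}-\frac12\mathrm{I}$ with $S$ the constant invertible diagonal relaxation matrix). Then the differential operators $\Gamma_1,\Psi_1,\Gamma_2,\Psi_2,\Gamma_3,\Psi_3,\Gamma_4$ defined in the context take the form $$\Gamma_j(W)=\alpha_j\,W\ (1\le j\le 4),\qquad \Psi_j(W)=\beta_j\,W\ (1\le j\le 3),$$ where the linear differential operators $\alpha_j,\beta_j$ are given by $$\begin{aligned} \alpha_1&=\overline A\,\partial_x+\overline B\,\delta,\\ \beta_1&=E\,\alpha_1-(\overline C\,\partial_x+\overline D\,\delta),\\ \alpha_2&=\overline B\,\Sigma\,\partial_x\,\beta_1,\\ \beta_2&=\Sigma\,\beta_1\,\alpha_1+E\,\alpha_2-\overline D\,\Sigma\,\partial_x\,\beta_1,\\ \alpha_3&=\overline B\,\Sigma\,\partial_x\,\beta_2+\tfrac1{12}\overline{B_2}\,\partial_x^2\,\beta_1-\tfrac16\overline B\,\partial_x\,\beta_1\,\alpha_1,\\ \beta_3&=\Sigma\,\beta_1\,\alpha_2+E\,\alpha_3-\overline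 D\,\Sigma\,\partial_x\,\beta_2+\Sigma\,\beta_2\,\alpha_1+\tfrac16\overline D\,\partial_x\,\beta_1\,\alpha_1-\tfrac1{12}\beta_1\,\alpha_1^2-\tfrac1{12}\overline{D_2}\,\partial_x^2\,\beta_1,\\ \alpha_4&=\overline B\,\Sigma\,\partial_x\,\beta_3+\tfrac14\overline{B_2}\,\partial_x^2\,\beta_2+\tfrac16\overline B\,\overline{D_2}\,\Sigma\,\partial_x^3\,\beta_1-\tfrac16\overline A\,\overline B\,\partial_x^2\,\beta_2\\ &\quad-\tfrac16\overline B\,\delta\,\alpha_1\,\alpha_2-\tfrac16\overline B\,\delta\,\alpha_2\,\alpha_1-\tfrac16\overline B\,\Sigma\,\partial_x\,\beta_1\,\alpha_1^2 . \end{aligned}$$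
   Context: $W=W(x)$ is a smooth function with values in $\mathbb{R}^N$ (conserved moments); the microscopic moments take values in $\mathbb{R}^P$. Products of operators are compositions; $E$ acts by multiplication by $E(x)$. For an operator $F$ acting on $W$, $\mathrm dF(W).\xi$ denotes its (Gateaux) derivative at $W$ in the direction $\xi$; expressions such as $\mathrm d(\mathrm dF.\,G).\,H(W)$ mean: differentiate the map $W\mapsto \mathrm dF(W).G(W)$ at $W$ in the direction $H(W)$. In the nested derivatives below, since all operators are linear, if $F,G,H$ are linear then $\mathrm dF(W).G(W)=FG\,W$ and $\mathrm d(\mathrm dF.G).H(W)=FGH\,W$. Second-order blocks: $B_2=AB+BD$, $D_2=CB+D^2$, so that $B_2=\overline{B_2}\,\partial_x^2$ with $\overline{B_2}=\overline A\,\overline B+\overline B\,\overline D$ and $D_2=\overline{D_2}\,\partial_x^2$ with $\overline{D_2}=\overline C\,\overline B+\overline D^{\,2}$. The operators are defined recursively by $$\begin{aligned} \Gamma_1(W)&=A\,W+B\,\Phi(W),\\ \Psi_1(W)&=\mathrm d\Phi(W).\Gamma_1(W)-\big(C\,W+D\,\Phi(W)\big),\\ \Gamma_2(W)&=B\,\Sigma\,\Psi_1(W),\\ \Psi_2(W)&=\Sigma\,\mathrm d\Psi_1(W).\Gamma_1(W)+\mathrm d\Phi(W).\Gamma_2(W)-D\,\Sigma\,\Psi_1(W),\\ \Gamma_3(W)&=B\,\Sigma\,\Psi_2(W)+\tfrac1{12}B_2\,\Psi_1(W)-\tfrac16B\,\mathrm d\Psi_1(W).\Gamma_1(W),\\ \Psi_3(W)&=\Sigma\,\mathrm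 d\Psi_1(W).\Gamma_2(W)+\mathrm d\Phi(W).\Gamma_3(W)-D\,\Sigma\,\Psi_2(W)+\Sigma\,\mathrm d\Psi_2(W).\Gamma_1(W)\\ &\quad+\tfrac16D\,\mathrm d\Psi_1(W).\Gamma_1(W)-\tfrac1{12}D_2\,\Psi_1(W)-\tfrac1{12}\mathrm d\big(\mathrm d\Psi_1.\Gamma_1\big).\Gamma_1(W),\\ \Gamma_4(W)&=B\,\Sigma\,\Psi_3(W)+\tfrac14B_2\,\Psi_2(W)+\tfrac16B\,D_2\,\Sigma\,\Psi_1(W)-\tfrac16A\,B\,\Psi_2(W)\\ &\quad-\tfrac16B\,\mathrm d(\mathrm d\Phi.\Gamma_1).\Gamma_2(W)-\tfrac16B\,\mathrm d(\mathrm d\Phi.\Gamma_2).\Gamma_1(W)-\tfrac16B\,\Sigma\,\mathrm d(\mathrm d\Psi_1.\Gamma_1).\Gamma_1(W). \end{aligned}$$ *)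

theory Defs
  imports "HOL-Analysis.Analysis"
begin

definition dx :: "(real \<Rightarrow> 'a::real_normed_vector) \<Rightarrow> real \<Rightarrow> 'a"
  where "dx f = (\<lambda>x. vector_derivative f (at x))"

definition smooth :: "(real \<Rightarrow> 'a::real_normed_vector) \<Rightarrow> bool"
  where "smooth f \<longleftrightarrow> (\<forall>k x. (dx ^^ k) f differentiable (at x))"

text \<open>
  Fields are arbitrary functions of \<open>x\<close>; the operators below are meaningful on smooth ones.
  The Gateaux derivative of \<open>F\<close> at \<open>W\<close> in the direction \<open>\<xi>\<close> is the limit of the difference
  quotients as \<open>t \<longlongrightarrow> 0\<close> in the usual topology of smooth functions, i.e. uniform convergence
  of all derivatives on compact sets. This topology is Hausdorff (take \<open>k = 0\<close> and a
  singleton \<open>K\<close>), so the limit is unique when it exists.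
\<close>

definition has_gateaux_derivative ::
  "((real \<Rightarrow> 'a::real_normed_vector) \<Rightarrow> real \<Rightarrow> 'b::real_normed_vector) \<Rightarrow>
   (real \<Rightarrow> 'a) \<Rightarrow> (real \<Rightarrow> 'a) \<Rightarrow> (real \<Rightarrow> 'b) \<Rightarrow> bool"
  where "has_gateaux_derivative F W \<xi> G \<longleftrightarrow>
    smooth G \<and>
    (\<forall>k K. compact K \<longrightarrow>
      uniform_limit K
        (\<lambda>t::real. (dx ^^ k) (\<lambda>x. (1 / t) *\<^sub>R (F (\<lambda>y. W y + t *\<^sub>R \<xi> y) x - F W x)))
        ((dx ^^ k) G) (at 0))"

definition gateaux ::
  "((real \<Rightarrow> 'a::real_normed_vector) \<Rightarrow> real \<Rightarrow> 'b::real_normed_vector) \<Rightarrow>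
   (real \<Rightarrow> 'a) \<Rightarrow> (real \<Rightarrow> 'a) \<Rightarrow> real \<Rightarrow> 'b"
  where "gateaux F W \<xi> = (THE G. has_gateaux_derivative F W \<xi> G)"

text \<open>The map \<open>W \<mapsto> dF(W).G(W)\<close>; thus \<open>d(dF.G).H\<close> is \<open>dalong (dalong F G) H\<close>.\<close>

definition dalong ::
  "((real \<Rightarrow> 'a::real_normed_vector) \<Rightarrow> real \<Rightarrow> 'b::real_normed_vector) \<Rightarrow>
   ((real \<Rightarrow> 'a) \<Rightarrow> real \<Rightarrow> 'a) \<Rightarrow> (real \<Rightarrow> 'a) \<Rightarrow> real \<Rightarrow> 'b"
  where "dalong F G W = gateaux F W (G W)"

definition mul :: "real^'a^'b \<Rightarrow> (real \<Rightarrow> real^'a) \<Rightarrow> real \<Rightarrow> real^'b"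
  where "mul M f = (\<lambda>x. M *v f x)"

definition mul_dx :: "real^'a^'b \<Rightarrow> (real \<Rightarrow> real^'a) \<Rightarrow> real \<Rightarrow> real^'b"
  where "mul_dx M f = mul M (dx f)"

definition linear_equilibrium ::
  "(real \<Rightarrow> real^'n^'p) \<Rightarrow> (real \<Rightarrow> real^'n) \<Rightarrow> real \<Rightarrow> real^'p"
  where "linear_equilibrium E W = (\<lambda>x. E x *v W x)"

context
  fixes Ab :: "real^'n^'n" and Bb :: "real^'p^'n" and Cb :: "real^'n^'p" and Db :: "real^'p^'p"
    and \<Sigma> :: "real^'p^'p"
begin

text \<open>\<open>B2\<close>, \<open>D2\<close> are compositions of operators; \<open>B2b\<close>, \<open>D2b\<close> are the matrices for which
  \<open>B2 = B2b \<partial>\<^sub>x\<^sup>2\<close> and \<open>D2 = D2b \<partial>\<^sub>x\<^sup>2\<close> on smooth fields.\<close>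

definition B2 :: "(real \<Rightarrow> real^'p) \<Rightarrow> real \<Rightarrow> real^'n"
  where "B2 V = (\<lambda>x. mul_dx Ab (mul_dx Bb V) x + mul_dx Bb (mul_dx Db V) x)"

definition D2 :: "(real \<Rightarrow> real^'p) \<Rightarrow> real \<Rightarrow> real^'p"
  where "D2 V = (\<lambda>x. mul_dx Cb (mul_dx Bb V) x + mul_dx Db (mul_dx Db V) x)"

definition B2b :: "real^'p^'n"
  where "B2b = Ab ** Bb + Bb ** Db"

definition D2b :: "real^'p^'p"
  where "D2b = Cb ** Bb + Db ** Db"

text \<open>The recursion for an arbitrary, possibly nonlinear, equilibrium operator \<open>\<Phi>\<close>.\<close>

context
  fixes \<Phi> :: "(real \<Rightarrow> real^'n) \<Rightarrow> real \<Rightarrow> real^'p"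
begin

definition Gamma1 :: "(real \<Rightarrow> real^'n) \<Rightarrow> real \<Rightarrow> real^'n" where
  "Gamma1 W = (\<lambda>x. mul_dx Ab W x + mul_dx Bb (\<Phi> W) x)"

definition Psi1 :: "(real \<Rightarrow> real^'n) \<Rightarrow> real \<Rightarrow> real^'p" where
  "Psi1 W = (\<lambda>x. dalong \<Phi> Gamma1 W x - (mul_dx Cb W x + mul_dx Db (\<Phi> W) x))"

definition Gamma2 :: "(real \<Rightarrow> real^'n) \<Rightarrow> real \<Rightarrow> real^'n" where
  "Gamma2 W = mul_dx Bb (mul \<Sigma> (Psi1 W))"

definition Psi2 :: "(real \<Rightarrow> real^'n) \<Rightarrow> real \<Rightarrow> real^'p" where
  "Psi2 W = (\<lambda>x.
      mul \<Sigma> (dalong Psi1 Gamma1 W) x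
    + dalong \<Phi> Gamma2 W x
    - mul_dx Db (mul \<Sigma> (Psi1 W)) x)"

definition Gamma3 :: "(real \<Rightarrow> real^'n) \<Rightarrow> real \<Rightarrow> real^'n" where
  "Gamma3 W = (\<lambda>x.
      mul_dx Bb (mul \<Sigma> (Psi2 W)) x
    + (1/12) *\<^sub>R B2 (Psi1 W) x
    - (1/6) *\<^sub>R mul_dx Bb (dalong Psi1 Gamma1 W) x)"

definition Psi3 :: "(real \<Rightarrow> real^'n) \<Rightarrow> real \<Rightarrow> real^'p" where
  "Psi3 W = (\<lambda>x.
      mul \<Sigma> (dalong Psi1 Gamma2 W) x
    + dalong \<Phi> Gamma3 W x
    - mul_dx Db (mul \<Sigma> (Psi2 W)) x
    + mul \<Sigma> (dalong Psi2 Gamma1 W) x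
    + (1/6) *\<^sub>R mul_dx Db (dalong Psi1 Gamma1 W) x
    - (1/12) *\<^sub>R D2 (Psi1 W) x
    - (1/12) *\<^sub>R dalong (dalong Psi1 Gamma1) Gamma1 W x)"

definition Gamma4 :: "(real \<Rightarrow> real^'n) \<Rightarrow> real \<Rightarrow> real^'n" where
  "Gamma4 W = (\<lambda>x.
      mul_dx Bb (mul \<Sigma> (Psi3 W)) x
    + (1/4) *\<^sub>R B2 (Psi2 W) x
    + (1/6) *\<^sub>R mul_dx Bb (D2 (mul \<Sigma> (Psi1 W))) x
    - (1/6) *\<^sub>R mul_dx Ab (mul_dx Bb (Psi2 W)) x
    - (1/6) *\<^sub>R mul_dx Bb (dalong (dalong \<Phi> Gamma1) Gamma2 W) x
    - (1/6) *\<^sub>R mul_dx Bb (dalong (dalong \<Phi> Gamma2) Gamma1 W) x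
    - (1/6) *\<^sub>R mul_dx Bb (mul \<Sigma> (dalong (dalong Psi1 Gamma1) Gamma1 W)) x)"

end

context
  fixes E :: "real \<Rightarrow> real^'n^'p"
begin

definition \<delta> :: "(real \<Rightarrow> real^'n) \<Rightarrow> real \<Rightarrow> real^'p"
  where "\<delta> W = dx (\<lambda>x. E x *v W x)"

definition \<alpha>1 :: "(real \<Rightarrow> real^'n) \<Rightarrow> real \<Rightarrow> real^'n" where
  "\<alpha>1 W = (\<lambda>x. Ab *v dx W x + Bb *v \<delta> W x)"

definition \<beta>1 :: "(real \<Rightarrow> real^'n) \<Rightarrow> real \<Rightarrow> real^'p" where
  "\<beta>1 W = (\<lambda>x. E x *v \<alpha>1 W x - (Cb *v dx W x + Db *v \<delta> W x))"

definition \<alpha>2 :: "(real \<Rightarrow> real^'n) \<Rightarrow> real \<Rightarrow> real^'n" where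
  "\<alpha>2 W = (\<lambda>x. (Bb ** \<Sigma>) *v dx (\<beta>1 W) x)"

definition \<beta>2 :: "(real \<Rightarrow> real^'n) \<Rightarrow> real \<Rightarrow> real^'p" where
  "\<beta>2 W = (\<lambda>x.
      \<Sigma> *v \<beta>1 (\<alpha>1 W) x
    + E x *v \<alpha>2 W x
    - (Db ** \<Sigma>) *v dx (\<beta>1 W) x)"

definition \<alpha>3 :: "(real \<Rightarrow> real^'n) \<Rightarrow> real \<Rightarrow> real^'n" where
  "\<alpha>3 W = (\<lambda>x.
      (Bb ** \<Sigma>) *v dx (\<beta>2 W) x
    + (1/12) *\<^sub>R (B2b *v (dx ^^ 2) (\<beta>1 W) x)
    - (1/6) *\<^sub>R (Bb *v dx (\<beta>1 (\<alpha>1 W)) x))"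

definition \<beta>3 :: "(real \<Rightarrow> real^'n) \<Rightarrow> real \<Rightarrow> real^'p" where
  "\<beta>3 W = (\<lambda>x.
      \<Sigma> *v \<beta>1 (\<alpha>2 W) x
    + E x *v \<alpha>3 W x
    - (Db ** \<Sigma>) *v dx (\<beta>2 W) x
    + \<Sigma> *v \<beta>2 (\<alpha>1 W) x
    + (1/6) *\<^sub>R (Db *v dx (\<beta>1 (\<alpha>1 W)) x)
    - (1/12) *\<^sub>R \<beta>1 (\<alpha>1 (\<alpha>1 W)) x
    - (1/12) *\<^sub>R (D2b *v (dx ^^ 2) (\<beta>1 W) x))"

definition \<alpha>4 :: "(real \<Rightarrow> real^'n) \<Rightarrow> real \<Rightarrow> real^'n" where
  "\<alpha>4 W = (\<lambda>x.
      (Bb ** \<Sigma>) *v dx (\<beta>3 W) x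
    + (1/4) *\<^sub>R (B2b *v (dx ^^ 2) (\<beta>2 W) x)
    + (1/6) *\<^sub>R ((Bb ** D2b ** \<Sigma>) *v (dx ^^ 3) (\<beta>1 W) x)
    - (1/6) *\<^sub>R ((Ab ** Bb) *v (dx ^^ 2) (\<beta>2 W) x)
    - (1/6) *\<^sub>R (Bb *v \<delta> (\<alpha>1 (\<alpha>2 W)) x)
    - (1/6) *\<^sub>R (Bb *v \<delta> (\<alpha>2 (\<alpha>1 W)) x)
    - (1/6) *\<^sub>R ((Bb ** \<Sigma>) *v dx (\<beta>1 (\<alpha>1 (\<alpha>1 W))) x))"

end

end

end

theory Submission
  imports Defs
begin

text \<open>
  Every operator in the recursion is built from \<open>\<partial>\<^sub>x\<close>, constant matrices and multiplication by \<open>E\<close>,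
  so for the linear equilibrium it is a linear map of the space of smooth fields into a space of
  smooth fields. The Gateaux derivative of such a map \<open>L\<close> at \<open>W\<close> in the direction \<open>\<xi>\<close> is \<open>L \<xi>\<close>: the
  difference quotient equals \<open>L \<xi>\<close> for every \<open>t \<noteq> 0\<close>, so its limit is trivial
  (\<open>gateaux_smooth_linear\<close>). Hence each \<open>dF.G\<close> in the recursion is the composition \<open>F G\<close>
  (\<open>dalong_smooth_linear\<close>), and since compositions are again linear the nested derivatives
  follow in the same way.

  What remains is that \<open>\<partial>\<^sub>x\<close> commutes with constant matrices, which turns \<open>B \<Sigma>\<close>, \<open>B\<^sub>2\<close>, \<open>D\<^sub>2\<close> and
  \<open>B D\<^sub>2 \<Sigma>\<close> into a matrix times a power of \<open>\<partial>\<^sub>x\<close>. The identities are proved in the order of the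
  recursion: to differentiate \<open>\<Psi>\<^sub>j\<close> one must know beforehand that it agrees with the linear operator
  \<open>\<beta>\<^sub>j\<close> at all smooth fields, not only at the one under consideration.

  The analytic input is that smooth fields are closed under sums, bounded linear maps and
  products such as \<open>E W\<close> (\<open>smooth_bounded_bilinear\<close>).
\<close>

section \<open>Smooth fields\<close>

lemma smooth_differentiable: "smooth f \<Longrightarrow> f differentiable at x"
  unfolding smooth_def by (metis funpow_0)

lemma smooth_dx: "smooth f \<Longrightarrow> smooth (dx f)"
  unfolding smooth_def by (metis funpow_Suc_right o_apply)

lemma smooth_dx_power: "smooth f \<Longrightarrow> smooth ((dx ^^ k) f)"
  by (induction k) (simp_all add: smooth_dx)

lemma has_vector_derivative_dx:
  "smooth f \<Longrightarrow> (f has_vector_derivative dx f x) (at x)"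
  unfolding dx_def using smooth_differentiable vector_derivative_works by blast

lemma dx_eqI:
  assumes "\<And>x. (f has_vector_derivative g x) (at x)"
  shows "dx f = g"
  unfolding dx_def using assms by (auto simp: fun_eq_iff intro: vector_derivative_at)

lemma differentiable_if_has_vector_derivative:
  "(f has_vector_derivative f') (at x) \<Longrightarrow> f differentiable at x"
  by (auto simp: has_vector_derivative_def differentiable_def)

lemma dx_add:
  "smooth f \<Longrightarrow> smooth g \<Longrightarrow> dx (\<lambda>x. f x + g x) = (\<lambda>x. dx f x + dx g x)"
  by (intro dx_eqI has_vector_derivative_add has_vector_derivative_dx)

lemma dx_bounded_linear:
  "bounded_linear L \<Longrightarrow> smooth f \<Longrightarrow> dx (\<lambda>x. L (f x)) = (\<lambda>x. L (dx f x))"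
  by (rule dx_eqI, rule bounded_linear.has_vector_derivative, assumption)
    (rule has_vector_derivative_dx)

lemma smooth_add:
  assumes "smooth f" "smooth g"
  shows "smooth (\<lambda>x. f x + g x)"
proof -
  have "(dx ^^ k) (\<lambda>x. f x + g x) = (\<lambda>x. (dx ^^ k) f x + (dx ^^ k) g x)" for k
    by (induction k) (simp_all add: dx_add smooth_dx_power assms)
  then show ?thesis
    using assms unfolding smooth_def by simp
qed

lemma smooth_bounded_linear:
  assumes L: "bounded_linear L" and "smooth f"
  shows "smooth (\<lambda>x. L (f x))"
proof -
  have "(dx ^^ k) (\<lambda>x. L (f x)) = (\<lambda>x. L ((dx ^^ k) f x))" for k
    by (induction k) (simp_all add: dx_bounded_linear[OF L] smooth_dx_power assms)
  moreover have "(\<lambda>x. L ((dx ^^ k) f x)) differentiable at x" for k x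
    by (rule differentiable_if_has_vector_derivative)
      (rule bounded_linear.has_vector_derivative[OF L
          has_vector_derivative_dx[OF smooth_dx_power[OF \<open>smooth f\<close>]]])
  ultimately show ?thesis
    unfolding smooth_def by simp
qed

text \<open>
  Products of smooth fields are not stable under \<open>\<partial>\<^sub>x\<close>, but finite sums of them are. That all
  derivatives of a product stay in this class replaces the Leibniz rule of order \<open>k\<close>.
\<close>

inductive sum_of_products ::
  "('a::real_normed_vector \<Rightarrow> 'b::real_normed_vector \<Rightarrow> 'c::real_normed_vector)
    \<Rightarrow> (real \<Rightarrow> 'c) \<Rightarrow> bool"
  for B where
  product: "smooth f \<Longrightarrow> smooth g \<Longrightarrow> sum_of_products B (\<lambda>x. B (f x) (g x))"
| sum: "sum_of_products B f \<Longrightarrow> sum_of_products B g \<Longrightarrow> sum_of_products B (\<lambda>x. f x + g x)"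

lemma sum_of_products_derivative:
  assumes "bounded_bilinear B" "sum_of_products B h"
  shows "\<exists>h'. (\<forall>x. (h has_vector_derivative h' x) (at x)) \<and> sum_of_products B h'"
  using assms(2)
proof induction
  case (product f g)
  have "((\<lambda>x. B (f x) (g x)) has_vector_derivative B (f x) (dx g x) + B (dx f x) (g x)) (at x)"
    for x
    by (intro bounded_bilinear.has_vector_derivative[OF assms(1)] has_vector_derivative_dx product)
  moreover have "sum_of_products B (\<lambda>x. B (f x) (dx g x) + B (dx f x) (g x))"
    by (intro sum_of_products.intros product smooth_dx)
  ultimately show ?case
    by (intro exI[of _ "\<lambda>x. B (f x) (dx g x) + B (dx f x) (g x)"] conjI allI)
next
  case (sum f g)
  from sum.IH obtain f' g' where
    f': "\<And>x. (f has_vector_derivative f' x) (at x)" "sum_of_products B f'" and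
    g': "\<And>x. (g has_vector_derivative g' x) (at x)" "sum_of_products B g'"
    by metis
  show ?case
    by (rule exI[of _ "\<lambda>x. f' x + g' x"])
      (blast intro: has_vector_derivative_add[OF f'(1) g'(1)] sum_of_products.sum[OF f'(2) g'(2)])
qed

lemma smooth_bounded_bilinear:
  assumes B: "bounded_bilinear B" and "smooth f" "smooth g"
  shows "smooth (\<lambda>x. B (f x) (g x))"
proof -
  have step: "(\<forall>x. h differentiable at x) \<and> sum_of_products B (dx h)"
    if h: "sum_of_products B h" for h
  proof -
    obtain h' where h': "\<And>x. (h has_vector_derivative h' x) (at x)" "sum_of_products B h'"
      using sum_of_products_derivative[OF B h] by metis
    then show ?thesis
      using dx_eqI[OF h'(1)] differentiable_if_has_vector_derivative[OF h'(1)] by simp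
  qed
  have "sum_of_products B ((dx ^^ k) (\<lambda>x. B (f x) (g x)))" for k
    by (induction k) (simp_all add: sum_of_products.product assms step)
  then show ?thesis
    unfolding smooth_def using step by metis
qed

lemma bounded_bilinear_matrix_vector_mult:
  "bounded_bilinear ((*v) :: real^'a^'b \<Rightarrow> real^'a \<Rightarrow> real^'b)"
  unfolding bilinear_conv_bounded_bilinear[symmetric] bilinear_def
  by (auto intro!: linearI simp: matrix_vector_mult_add_rdistrib matrix_vector_right_distrib
      scaleR_matrix_vector_assoc matrix_vector_mult_scaleR)

lemmas smooth_matrix_vector_mult = smooth_bounded_bilinear[OF bounded_bilinear_matrix_vector_mult]

lemma dx_matrix:
  fixes M :: "real^'a^'b"
  shows "smooth f \<Longrightarrow> dx (\<lambda>x. M *v f x) = (\<lambda>x. M *v dx f x)"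
  by (rule dx_bounded_linear[OF matrix_vector_mul_bounded_linear])

lemma smooth_matrix:
  fixes M :: "real^'a^'b"
  shows "smooth f \<Longrightarrow> smooth (\<lambda>x. M *v f x)"
  by (rule smooth_bounded_linear[OF matrix_vector_mul_bounded_linear])

section \<open>Linear operators on smooth fields and their Gateaux derivatives\<close>

text \<open>
  Linearity is required at smooth fields only: the value of \<open>dx\<close> at a point where a field is not
  differentiable is arbitrary, so \<open>\<partial>\<^sub>x\<close> itself is not additive on all fields.
\<close>

definition smooth_linear ::
  "((real \<Rightarrow> 'a::real_normed_vector) \<Rightarrow> real \<Rightarrow> 'b::real_normed_vector) \<Rightarrow> bool"
  where "smooth_linear F \<longleftrightarrow>
    (\<forall>V. smooth V \<longrightarrow> smooth (F V)) \<and>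
    (\<forall>U V. smooth U \<longrightarrow> smooth V \<longrightarrow> F (\<lambda>x. U x + V x) = (\<lambda>x. F U x + F V x)) \<and>
    (\<forall>c V. smooth V \<longrightarrow> F (\<lambda>x. c *\<^sub>R V x) = (\<lambda>x. c *\<^sub>R F V x))"

lemma smooth_linear_smooth: "smooth_linear F \<Longrightarrow> smooth V \<Longrightarrow> smooth (F V)"
  by (simp add: smooth_linear_def)

lemma smooth_linear_ident: "smooth_linear (\<lambda>W. W)"
  by (simp add: smooth_linear_def)

lemma smooth_linear_dx:
  assumes "smooth_linear F"
  shows "smooth_linear (\<lambda>W. dx (F W))"
  using assms unfolding smooth_linear_def
  by (simp add: smooth_dx dx_add dx_bounded_linear[OF bounded_linear_scaleR_right])

lemma smooth_linear_dx_power: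
  "smooth_linear F \<Longrightarrow> smooth_linear (\<lambda>W. (dx ^^ k) (F W))"
  by (induction k) (simp_all add: smooth_linear_dx)

lemma smooth_linear_add:
  "smooth_linear F \<Longrightarrow> smooth_linear G \<Longrightarrow> smooth_linear (\<lambda>W x. F W x + G W x)"
  unfolding smooth_linear_def by (simp add: smooth_add scaleR_add_right algebra_simps)

lemma smooth_linear_bounded_linear:
  assumes "bounded_linear L" "smooth_linear F"
  shows "smooth_linear (\<lambda>W x. L (F W x))"
proof -
  interpret bounded_linear L by fact
  show ?thesis
    using assms unfolding smooth_linear_def by (simp add: smooth_bounded_linear add scaleR)
qed

lemma smooth_linear_matrix:
  fixes M :: "real^'a^'b"
  shows "smooth_linear F \<Longrightarrow> smooth_linear (\<lambda>W x. M *v F W x)"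
  by (rule smooth_linear_bounded_linear[OF matrix_vector_mul_bounded_linear])

lemmas smooth_linear_scaleR = smooth_linear_bounded_linear[OF bounded_linear_scaleR_right]

lemma smooth_linear_diff:
  assumes "smooth_linear F" "smooth_linear G"
  shows "smooth_linear (\<lambda>W x. F W x - G W x)"
  using smooth_linear_add[OF assms(1) smooth_linear_scaleR[OF assms(2), of "-1"]] by simp

lemma smooth_linear_mult:
  fixes E :: "real \<Rightarrow> real^'a^'b"
  shows "smooth E \<Longrightarrow> smooth_linear F \<Longrightarrow> smooth_linear (\<lambda>W x. E x *v F W x)"
  unfolding smooth_linear_def
  by (simp add: smooth_matrix_vector_mult matrix_vector_right_distrib matrix_vector_mult_scaleR)

lemma smooth_linear_compose:
  "smooth_linear F \<Longrightarrow> smooth_linear G \<Longrightarrow> smooth_linear (\<lambda>W. F (G W))"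
  unfolding smooth_linear_def by simp

lemma has_gateaux_derivative_unique:
  assumes "has_gateaux_derivative F W \<xi> G" "has_gateaux_derivative F W \<xi> H"
  shows "G = H"
proof
  fix x
  \<comment> \<open>Order \<open>0\<close> and the compact set \<open>{x}\<close> give pointwise limits.\<close>
  have lim: "((\<lambda>t::real. (1 / t) *\<^sub>R (F (\<lambda>y. W y + t *\<^sub>R \<xi> y) x - F W x)) \<longlongrightarrow> J x) (at 0)"
    if "has_gateaux_derivative F W \<xi> J" for J
  proof -
    have "uniform_limit {x}
        (\<lambda>t::real. (dx ^^ 0) (\<lambda>x. (1 / t) *\<^sub>R (F (\<lambda>y. W y + t *\<^sub>R \<xi> y) x - F W x)))
        ((dx ^^ 0) J) (at 0)"
      by (rule conjunct2[OF that[unfolded has_gateaux_derivative_def], rule_format]) simp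
    from tendsto_uniform_limitI[OF this, of x] show ?thesis by simp
  qed
  show "G x = H x"
    by (rule tendsto_unique[OF _ lim[OF assms(1)] lim[OF assms(2)]]) simp
qed

text \<open>
  The operator \<open>F\<close> only has to agree with a linear one at smooth fields, because \<open>W + t \<xi>\<close> is
  smooth for all \<open>t\<close>.
\<close>

lemma gateaux_smooth_linear:
  assumes L: "smooth_linear L" and F: "\<And>V. smooth V \<Longrightarrow> F V = L V"
    and W: "smooth W" and \<xi>: "smooth \<xi>"
  shows "gateaux F W \<xi> = L \<xi>"
proof -
  have quotient: "(\<lambda>x. (1 / t) *\<^sub>R (F (\<lambda>y. W y + t *\<^sub>R \<xi> y) x - F W x)) = L \<xi>"
    if "t \<noteq> 0" for t :: real
  proof -
    have t\<xi>: "smooth (\<lambda>y. t *\<^sub>R \<xi> y)"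
      by (rule smooth_bounded_linear[OF bounded_linear_scaleR_right \<xi>])
    have "F (\<lambda>y. W y + t *\<^sub>R \<xi> y) = (\<lambda>x. L W x + t *\<^sub>R L \<xi> x)"
      using L W \<xi> t\<xi> unfolding F[OF smooth_add[OF W t\<xi>]] smooth_linear_def by simp
    with F[OF W] that show ?thesis by simp
  qed
  have derivative: "has_gateaux_derivative F W \<xi> (L \<xi>)"
    unfolding has_gateaux_derivative_def
  proof (intro conjI allI impI)
    show "smooth (L \<xi>)" using L \<xi> by (rule smooth_linear_smooth)
  next
    fix k and K :: "real set"
    have "\<forall>\<^sub>F t::real in at 0. \<forall>x\<in>K.
        (dx ^^ k) (\<lambda>x. (1 / t) *\<^sub>R (F (\<lambda>y. W y + t *\<^sub>R \<xi> y) x - F W x)) x = (dx ^^ k) (L \<xi>) x"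
      unfolding eventually_at_filter by (simp add: quotient)
    from iffD2[OF uniform_limit_cong[OF this refl] uniform_limit_const]
    show "uniform_limit K
        (\<lambda>t::real. (dx ^^ k) (\<lambda>x. (1 / t) *\<^sub>R (F (\<lambda>y. W y + t *\<^sub>R \<xi> y) x - F W x)))
        ((dx ^^ k) (L \<xi>)) (at 0)" .
  qed
  then show ?thesis
    unfolding gateaux_def
    using has_gateaux_derivative_unique[OF _ derivative]
    by (rule the_equality[where P = "has_gateaux_derivative F W \<xi>"])
qed

lemma dalong_smooth_linear:
  assumes "smooth_linear L" "smooth_linear M" "smooth W"
    and "\<And>V. smooth V \<Longrightarrow> F V = L V" "\<And>V. smooth V \<Longrightarrow> G V = M V"
  shows "dalong F G W = L (M W)"
  unfolding dalong_def assms(5)[OF assms(3)]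
  by (rule gateaux_smooth_linear[OF assms(1,4,3) smooth_linear_smooth[OF assms(2,3)]])

section \<open>Constant-coefficient blocks\<close>

lemma mul_dx_mul: "smooth V \<Longrightarrow> mul_dx M (mul N V) = (\<lambda>x. (M ** N) *v dx V x)"
  by (simp add: mul_dx_def mul_def dx_matrix matrix_vector_mul_assoc)

lemma mul_dx_mul_dx:
  "smooth V \<Longrightarrow> mul_dx M (mul_dx N V) = (\<lambda>x. (M ** N) *v (dx ^^ 2) V x)"
  by (simp add: mul_dx_mul smooth_dx mul_dx_def[of N] numeral_2_eq_2)

lemma B2_eq: "smooth V \<Longrightarrow> B2 Ab Bb Db V = (\<lambda>x. B2b Ab Bb Db *v (dx ^^ 2) V x)"
  by (simp add: B2_def B2b_def mul_dx_mul_dx matrix_vector_mult_add_rdistrib)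

lemma D2_eq: "smooth V \<Longrightarrow> D2 Bb Cb Db V = (\<lambda>x. D2b Bb Cb Db *v (dx ^^ 2) V x)"
  by (simp add: D2_def D2b_def mul_dx_mul_dx matrix_vector_mult_add_rdistrib)

lemma mul_dx_D2_mul:
  assumes "smooth V"
  shows "mul_dx M (D2 Bb Cb Db (mul N V)) = (\<lambda>x. (M ** D2b Bb Cb Db ** N) *v (dx ^^ 3) V x)"
proof -
  have "D2 Bb Cb Db (mul N V) = (\<lambda>x. (D2b Bb Cb Db ** N) *v (dx ^^ 2) V x)"
    using assms by (simp add: D2_eq mul_def smooth_matrix dx_matrix smooth_dx numeral_2_eq_2
        matrix_vector_mul_assoc)
  then show ?thesis
    using assms by (simp add: mul_dx_def mul_def dx_matrix smooth_dx_power matrix_vector_mul_assoc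
        matrix_mul_assoc numeral_3_eq_3 numeral_2_eq_2 smooth_dx)
qed

section \<open>The recursion for a linear equilibrium\<close>

context
  fixes Ab :: "real^'n^'n" and Bb :: "real^'p^'n" and Cb :: "real^'n^'p" and Db :: "real^'p^'p"
    and \<Sigma> :: "real^'p^'p" and E :: "real \<Rightarrow> real^'n^'p"
  assumes smooth_E: "smooth E"
begin

abbreviation (input) "\<phi> \<equiv> linear_equilibrium E"
abbreviation (input) "a1 \<equiv> \<alpha>1 Ab Bb E"
abbreviation (input) "b1 \<equiv> \<beta>1 Ab Bb Cb Db E"
abbreviation (input) "a2 \<equiv> \<alpha>2 Ab Bb Cb Db \<Sigma> E"
abbreviation (input) "b2 \<equiv> \<beta>2 Ab Bb Cb Db \<Sigma> E"
abbreviation (input) "a3 \<equiv> \<alpha>3 Ab Bb Cb Db \<Sigma> E"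
abbreviation (input) "b3 \<equiv> \<beta>3 Ab Bb Cb Db \<Sigma> E"

lemmas smooth_linear_intros = smooth_linear_ident smooth_linear_dx smooth_linear_dx_power
  smooth_linear_add smooth_linear_diff smooth_linear_scaleR smooth_linear_matrix
  smooth_linear_mult[OF smooth_E]

lemma smooth_linear_equilibrium: "smooth_linear \<phi>"
  unfolding linear_equilibrium_def[abs_def] by (intro smooth_linear_intros)

lemma smooth_linear_a1: "smooth_linear a1"
  unfolding \<alpha>1_def[abs_def] \<delta>_def by (intro smooth_linear_intros)

lemma smooth_linear_b1: "smooth_linear b1"
  unfolding \<beta>1_def[abs_def] \<delta>_def by (intro smooth_linear_intros smooth_linear_a1)

lemma smooth_linear_a2: "smooth_linear a2"
  unfolding \<alpha>2_def[abs_def] by (intro smooth_linear_intros smooth_linear_b1)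

lemmas smooth_linear_b1_a1 = smooth_linear_compose[OF smooth_linear_b1 smooth_linear_a1]

lemma smooth_linear_b2: "smooth_linear b2"
  unfolding \<beta>2_def[abs_def]
  by (intro smooth_linear_intros smooth_linear_b1_a1 smooth_linear_a2 smooth_linear_b1)

lemma smooth_linear_a3: "smooth_linear a3"
  unfolding \<alpha>3_def[abs_def]
  by (intro smooth_linear_intros smooth_linear_b1_a1 smooth_linear_b2 smooth_linear_b1)

lemma smooth_linear_b3: "smooth_linear b3"
  unfolding \<beta>3_def[abs_def]
  by (intro smooth_linear_intros smooth_linear_b1_a1 smooth_linear_a3 smooth_linear_b2
      smooth_linear_b1 smooth_linear_compose[OF smooth_linear_b1 smooth_linear_a2]
      smooth_linear_compose[OF smooth_linear_b2 smooth_linear_a1]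
      smooth_linear_compose[OF smooth_linear_b1_a1 smooth_linear_a1])

lemmas smooth_b1 = smooth_linear_smooth[OF smooth_linear_b1]
lemmas smooth_b2 = smooth_linear_smooth[OF smooth_linear_b2]
lemmas smooth_b3 = smooth_linear_smooth[OF smooth_linear_b3]

lemma Gamma1_eq: "Gamma1 Ab Bb \<phi> W = a1 W"
  by (simp add: Gamma1_def \<alpha>1_def mul_dx_def mul_def linear_equilibrium_def \<delta>_def)

lemma dalong_Phi:
  assumes "smooth_linear M" "smooth W" "\<And>V. smooth V \<Longrightarrow> G V = M V"
  shows "dalong \<phi> G W = (\<lambda>x. E x *v M W x)"
  by (rule trans[OF dalong_smooth_linear[OF smooth_linear_equilibrium assms(1,2) refl assms(3)]])
    (simp_all add: linear_equilibrium_def)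

lemma Psi1_eq: "smooth W \<Longrightarrow> Psi1 Ab Bb Cb Db \<phi> W = b1 W"
  by (simp add: Psi1_def \<beta>1_def dalong_Phi[OF smooth_linear_a1 _ Gamma1_eq] mul_dx_def mul_def
      linear_equilibrium_def \<delta>_def)

lemma Gamma2_eq: "smooth W \<Longrightarrow> Gamma2 Ab Bb Cb Db \<Sigma> \<phi> W = a2 W"
  by (simp add: Gamma2_def \<alpha>2_def Psi1_eq mul_dx_mul smooth_b1)

lemma dalong_Psi1_Gamma1:
  "smooth W \<Longrightarrow> dalong (Psi1 Ab Bb Cb Db \<phi>) (Gamma1 Ab Bb \<phi>) W = b1 (a1 W)"
  by (rule dalong_smooth_linear[OF smooth_linear_b1 smooth_linear_a1 _ Psi1_eq Gamma1_eq])

lemma Psi2_eq: "smooth W \<Longrightarrow> Psi2 Ab Bb Cb Db \<Sigma> \<phi> W = b2 W"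
  by (simp add: Psi2_def \<beta>2_def dalong_Psi1_Gamma1 dalong_Phi[OF smooth_linear_a2 _ Gamma2_eq]
      Psi1_eq mul_dx_mul smooth_b1 mul_def[of \<Sigma> "b1 (a1 W)"])

lemma Gamma3_eq: "smooth W \<Longrightarrow> Gamma3 Ab Bb Cb Db \<Sigma> \<phi> W = a3 W"
  by (simp add: Gamma3_def \<alpha>3_def dalong_Psi1_Gamma1 Psi1_eq Psi2_eq mul_dx_mul B2_eq smooth_b1
      smooth_b2 mul_dx_def[of Bb "b1 (a1 W)"] mul_def[of Bb "dx (b1 (a1 W))"])

lemma dalong_Psi1_Gamma2:
  "smooth W \<Longrightarrow> dalong (Psi1 Ab Bb Cb Db \<phi>) (Gamma2 Ab Bb Cb Db \<Sigma> \<phi>) W = b1 (a2 W)"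
  by (rule dalong_smooth_linear[OF smooth_linear_b1 smooth_linear_a2 _ Psi1_eq Gamma2_eq])

lemma dalong_Psi2_Gamma1:
  "smooth W \<Longrightarrow> dalong (Psi2 Ab Bb Cb Db \<Sigma> \<phi>) (Gamma1 Ab Bb \<phi>) W = b2 (a1 W)"
  by (rule dalong_smooth_linear[OF smooth_linear_b2 smooth_linear_a1 _ Psi2_eq Gamma1_eq])

lemma dalong_dalong_Psi1_Gamma1:
  "smooth W \<Longrightarrow>
    dalong (dalong (Psi1 Ab Bb Cb Db \<phi>) (Gamma1 Ab Bb \<phi>)) (Gamma1 Ab Bb \<phi>) W = b1 (a1 (a1 W))"
  by (rule dalong_smooth_linear[OF smooth_linear_b1_a1 smooth_linear_a1 _
        dalong_Psi1_Gamma1 Gamma1_eq])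

lemma Psi3_eq: "smooth W \<Longrightarrow> Psi3 Ab Bb Cb Db \<Sigma> \<phi> W = b3 W"
  by (simp add: Psi3_def \<beta>3_def dalong_Psi1_Gamma1 dalong_Psi1_Gamma2 dalong_Psi2_Gamma1
      dalong_dalong_Psi1_Gamma1 dalong_Phi[OF smooth_linear_a3 _ Gamma3_eq] Psi1_eq Psi2_eq
      mul_dx_mul D2_eq smooth_b1 smooth_b2 mul_dx_def[of Db "b1 (a1 W)"]
      mul_def[of \<Sigma> "b1 (a2 W)"] mul_def[of \<Sigma> "b2 (a1 W)"] mul_def[of Db "dx (b1 (a1 W))"]
      fun_eq_iff algebra_simps)

text \<open>
  This is where \<open>\<delta>\<close> enters \<open>\<alpha>4\<close>: the outer \<open>d\<Phi>\<close> leaves a factor \<open>E\<close>, which \<open>B\<close> then differentiates.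
\<close>

lemma mul_dx_dalong_dalong_Phi:
  assumes "smooth_linear M" "smooth_linear N" "smooth W"
    and "\<And>V. smooth V \<Longrightarrow> G V = M V" "\<And>V. smooth V \<Longrightarrow> H V = N V"
  shows "mul_dx Bb (dalong (dalong \<phi> G) H W) = (\<lambda>x. Bb *v \<delta> E (M (N W)) x)"
proof -
  have "dalong (dalong \<phi> G) H W = (\<lambda>x. E x *v M (N W) x)"
    by (rule dalong_smooth_linear[OF smooth_linear_mult[OF smooth_E assms(1)] assms(2,3)
          dalong_Phi[OF assms(1) _ assms(4)] assms(5)])
  then show ?thesis by (simp add: mul_dx_def mul_def \<delta>_def)
qed

lemma Gamma4_eq:
  assumes W: "smooth W"
  shows "Gamma4 Ab Bb Cb Db \<Sigma> \<phi> W = \<alpha>4 Ab Bb Cb Db \<Sigma> E W"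
proof -
  have "smooth (b1 (a1 (a1 W)))"
    using W by (intro smooth_b1 smooth_linear_smooth[OF smooth_linear_a1])
  then show ?thesis
    using W by (simp add: Gamma4_def \<alpha>4_def Psi1_eq Psi2_eq Psi3_eq mul_dx_mul mul_dx_mul_dx
        mul_dx_D2_mul B2_eq smooth_b1 smooth_b2 smooth_b3 dalong_dalong_Psi1_Gamma1
        mul_dx_dalong_dalong_Phi[OF smooth_linear_a1 smooth_linear_a2 _ Gamma1_eq Gamma2_eq]
        mul_dx_dalong_dalong_Phi[OF smooth_linear_a2 smooth_linear_a1 _ Gamma2_eq Gamma1_eq])
qed

end

theorem proposition3:
  fixes Ab :: "real^'n^'n" and Bb :: "real^'p^'n" and Cb :: "real^'n^'p" and Db :: "real^'p^'p"
    and S \<Sigma> :: "real^'p^'p"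
    and E :: "real \<Rightarrow> real^'n^'p"
    and \<Phi> :: "(real \<Rightarrow> real^'n) \<Rightarrow> real \<Rightarrow> real^'p"
    and W :: "real \<Rightarrow> real^'n"
  assumes "\<forall>i j. i \<noteq> j \<longrightarrow> S $ i $ j = 0" and "invertible S"
    and "\<Sigma> = matrix_inv S - (1/2) *\<^sub>R mat 1"
    and "smooth E"
    and "\<Phi> = linear_equilibrium E"
    and "smooth W"
  shows "Gamma1 Ab Bb \<Phi> W = \<alpha>1 Ab Bb E W
    \<and> Psi1 Ab Bb Cb Db \<Phi> W = \<beta>1 Ab Bb Cb Db E W
    \<and> Gamma2 Ab Bb Cb Db \<Sigma> \<Phi> W = \<alpha>2 Ab Bb Cb Db \<Sigma> E W
    \<and> Psi2 Ab Bb Cb Db \<Sigma> \<Phi> W = \<beta>2 Ab Bb Cb Db \<Sigma> E W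
    \<and> Gamma3 Ab Bb Cb Db \<Sigma> \<Phi> W = \<alpha>3 Ab Bb Cb Db \<Sigma> E W
    \<and> Psi3 Ab Bb Cb Db \<Sigma> \<Phi> W = \<beta>3 Ab Bb Cb Db \<Sigma> E W
    \<and> Gamma4 Ab Bb Cb Db \<Sigma> \<Phi> W = \<alpha>4 Ab Bb Cb Db \<Sigma> E W"
  unfolding \<open>\<Phi> = linear_equilibrium E\<close> using \<open>smooth E\<close> \<open>smooth W\<close>
  by (simp add: Gamma1_eq Psi1_eq Gamma2_eq Psi2_eq Gamma3_eq Psi3_eq Gamma4_eq)

end
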